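(* Let $q>1$. The zero solution of the Ambartsumian equation $$y'(t)=-y(t)+\frac{1}{q}\,y\left(\frac{t}{q}\right),\qquad t\ge 0,$$ is asymptotically stable.
   Context: For $c\in\mathbb{R}$ let $y(\cdot;c)$ denote the solution on $[0,\infty)$ with $y(0;c)=c$. The zero solution is stable if for every $\epsilon>0$ there is $\delta>0$ such that $|c|<\delta$ implies $|y(t;c)|<\epsilon$ for all $t\ge 0$. It is asymptotically stable if it is stable and moreover $\lim_{t\to\infty}|y(t;c)|=0$ for all $c$ sufficiently close to $0$. *)

theory Defs
  imports Complex_Main "HOL-Library.FuncSet"
begin

text \<open>The derivative is taken within the half-line, so it is one-sided at \<open>t = 0\<close>.\<close>

definition ambartsumian_solution :: "real \<Rightarrow> (real \<Rightarrow> real) \<Rightarrow> bool" where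
  "ambartsumian_solution q y \<longleftrightarrow>
     (\<forall>t\<ge>0. (y has_real_derivative (- y t + (1 / q) * y (t / q))) (at t within {0..}))"

text \<open>A solution is a function on \<open>{0..}\<close> only. Requiring it to be extensional fixes the
  irrelevant values at negative arguments, so that the description is unique. The argument
  order of \<open>ambartsumian_sol q c t\<close> corresponds to \<open>y(t; c)\<close>.\<close>

definition ambartsumian_sol :: "real \<Rightarrow> real \<Rightarrow> real \<Rightarrow> real" where
  "ambartsumian_sol q c =
     (THE y. y \<in> extensional {0..} \<and> ambartsumian_solution q y \<and> y 0 = c)"

text \<open>Below, \<open>y c\<close> is the solution with initial value \<open>c\<close>; the notions concern the zero
  solution.\<close>

definition zero_stable :: "(real \<Rightarrow> real \<Rightarrow> real) \<Rightarrow> bool" where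
  "zero_stable y \<longleftrightarrow>
     (\<forall>\<epsilon>>0. \<exists>\<delta>>0. \<forall>c. \<bar>c\<bar> < \<delta> \<longrightarrow> (\<forall>t\<ge>0. \<bar>y c t\<bar> < \<epsilon>))"

definition zero_asymptotically_stable :: "(real \<Rightarrow> real \<Rightarrow> real) \<Rightarrow> bool" where
  "zero_asymptotically_stable y \<longleftrightarrow>
     zero_stable y \<and>
     (\<exists>\<delta>>0. \<forall>c. \<bar>c\<bar> < \<delta> \<longrightarrow> ((\<lambda>t. \<bar>y c t\<bar>) \<longlongrightarrow> 0) at_top)"

end

theory Submission imports Defs begin

text \<open>For small \<open>\<alpha> > 0\<close> the function \<open>V t = (1 + t) powr - \<alpha>\<close> is a strict supersolution:
  since \<open>1 + t / q \<ge> (1 + t) / q\<close>, one has \<open>V (t / q) \<le> q powr \<alpha> * V t\<close>, and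
  \<open>\<alpha> + q powr (\<alpha> - 1) < 1\<close> for small \<open>\<alpha>\<close>. A maximum point \<open>t > 0\<close> of
  \<open>\<bar>y\<bar> / V\<close> on a compact interval would contradict this, so every solution satisfies
  \<open>\<bar>y t\<bar> \<le> \<bar>y 0\<bar> * V t\<close>. This gives uniqueness, stability and decay at once;
  existence comes from an everywhere convergent power series.\<close>

text \<open>At \<alpha> = 0 the left side equals \<open>1 / q\<close>, which is below 1; continuity
  in \<alpha> keeps it below 1 for small positive \<alpha>.\<close>

lemma exists_decay_exponent:
  fixes q :: real
  assumes "q > 1"
  shows "\<exists>\<alpha>>0. \<alpha> + q powr \<alpha> / q < 1"
proof -
  have "((\<lambda>a. a + q powr a / q) \<longlongrightarrow> 0 + q powr 0 / q) (at_right 0)"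
    using assms by (intro tendsto_intros) auto
  moreover have "0 + q powr 0 / q < 1"
    using assms by simp
  ultimately have "\<forall>\<^sub>F a in at_right 0. a + q powr a / q < 1"
    by (rule order_tendstoD)
  moreover have "\<forall>\<^sub>F a in at_right (0::real). a > 0"
    by (simp add: eventually_at_right_less)
  ultimately have "\<forall>\<^sub>F a in at_right (0::real). a > 0 \<and> a + q powr a / q < 1"
    by eventually_elim simp
  then show ?thesis
    using eventually_happens' trivial_limit_at_right_real by blast
qed

text \<open>The right side is the derivative of \<open>(1 + t) powr - \<alpha>\<close>, so this is
  the strict differential inequality that drives the comparison argument.\<close>

lemma powr_strict_supersolution:
  fixes q \<alpha> t :: real
  assumes "q > 1" "\<alpha> > 0" "\<alpha> + q powr \<alpha> / q < 1" "t \<ge> 0"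
  shows "- ((1 + t) powr - \<alpha>) + (1 / q) * (1 + t / q) powr - \<alpha>
           < - \<alpha> * (1 + t) powr (- \<alpha> - 1)"
proof -
  define v where "v = (1 + t) powr - \<alpha>"
  have v: "v > 0" using assms unfolding v_def by simp
  have "(1 + t / q) powr - \<alpha> \<le> ((1 + t) / q) powr - \<alpha>"
    using assms by (intro powr_mono2') (auto simp: field_simps)
  also have "\<dots> = q powr \<alpha> * v"
    using assms by (simp add: v_def powr_divide powr_minus field_simps)
  finally have "(1 / q) * (1 + t / q) powr - \<alpha> \<le> (q powr \<alpha> / q) * v"
    using assms by (simp add: field_simps)
  also have "\<dots> < (1 - \<alpha>) * v"
    using assms v by (intro mult_strict_right_mono) auto
  finally have 1: "- v + (1 / q) * (1 + t / q) powr - \<alpha> < - \<alpha> * v"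
    by (simp add: algebra_simps)
  \<comment> \<open>As \<open>1 + t\<close> \<ge> 1, lowering the exponent only decreases the power.
    Hence the derivative is at least \<open>- \<alpha> * v\<close>.\<close>
  have "(1 + t) powr (- \<alpha> - 1) \<le> v"
    unfolding v_def using assms by (intro powr_mono) auto
  then have "\<alpha> * (1 + t) powr (- \<alpha> - 1) \<le> \<alpha> * v"
    using assms by (intro mult_left_mono) auto
  then show ?thesis
    using 1 unfolding v_def by linarith
qed

lemma ambartsumian_solution_continuous_on:
  assumes "ambartsumian_solution q y"
  shows "continuous_on {0..} y"
  using assms unfolding ambartsumian_solution_def
  by (auto simp: continuous_on_eq_continuous_within intro!: DERIV_continuous)

lemma ambartsumian_solution_cmult:
  assumes "ambartsumian_solution q y"
  shows "ambartsumian_solution q (\<lambda>t. k * y t)"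
  unfolding ambartsumian_solution_def
proof (intro allI impI)
  fix t :: real assume "t \<ge> 0"
  then have "(y has_real_derivative - y t + (1 / q) * y (t / q)) (at t within {0..})"
    using assms by (simp add: ambartsumian_solution_def)
  from DERIV_cmult[OF this, of k]
  show "((\<lambda>t. k * y t) has_real_derivative - (k * y t) + (1 / q) * (k * y (t / q)))
          (at t within {0..})"
    by (simp add: algebra_simps)
qed

lemma ambartsumian_solution_diff:
  assumes "ambartsumian_solution q y" "ambartsumian_solution q z"
  shows "ambartsumian_solution q (\<lambda>t. y t - z t)"
  unfolding ambartsumian_solution_def
proof (intro allI impI)
  fix t :: real assume t: "t \<ge> 0"
  have "(y has_real_derivative - y t + (1 / q) * y (t / q)) (at t within {0..})"
    "(z has_real_derivative - z t + (1 / q) * z (t / q)) (at t within {0..})"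
    using assms t by (simp_all add: ambartsumian_solution_def)
  from DERIV_diff[OF this]
  show "((\<lambda>t. y t - z t) has_real_derivative - (y t - z t) + (1 / q) * (y (t / q) - z (t / q)))
          (at t within {0..})"
    by (simp add: algebra_simps)
qed

text \<open>At the touching point the delayed value \<open>y (t / q)\<close> still lies under the
  barrier, because \<open>t / q\<close> \<le> \<open>t\<close>. Strictness of the supersolution then
  makes \<open>y\<close> minus the barrier strictly decreasing through its zero at \<open>t\<close>,
  so it is positive just to the left, against \<open>le\<close>.\<close>

lemma ambartsumian_no_interior_touching:
  fixes q \<alpha> M t :: real
  assumes sol: "ambartsumian_solution q y" and q: "q > 1"
    and \<alpha>: "\<alpha> > 0" "\<alpha> + q powr \<alpha> / q < 1"
    and M: "M > 0" and t: "t > 0"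
    and le: "\<And>s. 0 \<le> s \<Longrightarrow> s \<le> t \<Longrightarrow> y s \<le> M * (1 + s) powr - \<alpha>"
    and eq: "y t = M * (1 + t) powr - \<alpha>"
  shows False
proof -
  define D where "D = - y t + (1 / q) * y (t / q) - M * (- \<alpha> * (1 + t) powr (- \<alpha> - 1))"
  have "(y has_real_derivative - y t + (1 / q) * y (t / q)) (at t within {0..})"
    using sol t by (simp add: ambartsumian_solution_def)
  \<comment> \<open>As \<open>t\<close> > 0 is interior to the half-line, the derivative there is
    two-sided.\<close>
  then have "(y has_real_derivative - y t + (1 / q) * y (t / q)) (at t within {0<..})"
    by (rule has_field_derivative_subset) auto
  then have "(y has_real_derivative - y t + (1 / q) * y (t / q)) (at t)"
    using t at_within_open[of t "{0<..}"] by simp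
  moreover have "((\<lambda>s. M * (1 + s) powr - \<alpha>) has_real_derivative
      M * (- \<alpha> * (1 + t) powr (- \<alpha> - 1))) (at t)"
    using t by (auto intro!: derivative_eq_intros simp: powr_diff)
  ultimately have der: "((\<lambda>s. y s - M * (1 + s) powr - \<alpha>) has_real_derivative D) (at t)"
    unfolding D_def by (rule DERIV_diff)
  have "t / q \<le> t" using q t by (simp add: field_simps)
  then have "y (t / q) \<le> M * (1 + t / q) powr - \<alpha>"
    using q t by (intro le) auto
  then have "(1 / q) * y (t / q) \<le> (1 / q) * (M * (1 + t / q) powr - \<alpha>)"
    using q by (intro mult_left_mono) auto
  moreover have "M * (- ((1 + t) powr - \<alpha>) + (1 / q) * (1 + t / q) powr - \<alpha>)
      < M * (- \<alpha> * (1 + t) powr (- \<alpha> - 1))"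
    using powr_strict_supersolution[OF q \<alpha>, of t] t M
    by (intro mult_strict_left_mono) auto
  ultimately have "D < 0"
    unfolding D_def eq by (simp add: algebra_simps)
  from DERIV_neg_dec_left[OF der this] obtain d where d: "d > 0"
    "\<And>h. h > 0 \<Longrightarrow> h < d \<Longrightarrow>
        y t - M * (1 + t) powr - \<alpha> < y (t - h) - M * (1 + (t - h)) powr - \<alpha>"
    by blast
  \<comment> \<open>The cap by \<open>t\<close> keeps \<open>t - h\<close> nonnegative, where
    \<open>le\<close> applies.\<close>
  define h where "h = min (d / 2) t"
  have "h > 0" "h < d" "h \<le> t" using d(1) t by (auto simp: h_def)
  then show False
    using d(2)[of h] le[of "t - h"] eq by simp
qed

lemma ambartsumian_solution_bound:
  fixes q \<alpha> t :: real
  assumes sol: "ambartsumian_solution q y" and q: "q > 1"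
    and \<alpha>: "\<alpha> > 0" "\<alpha> + q powr \<alpha> / q < 1" and t: "t \<ge> 0"
  shows "\<bar>y t\<bar> \<le> \<bar>y 0\<bar> * (1 + t) powr - \<alpha>"
proof -
  define g where "g = (\<lambda>s. \<bar>y s\<bar> * (1 + s) powr \<alpha>)"
  have g: "\<bar>y s\<bar> = g s * (1 + s) powr - \<alpha>" if "s \<ge> 0" for s
    using that by (simp add: g_def powr_minus)
  have "continuous_on {0..t} y"
    using ambartsumian_solution_continuous_on[OF sol] by (rule continuous_on_subset) auto
  then have "continuous_on {0..t} g"
    unfolding g_def by (intro continuous_intros) auto
  then obtain m where m: "0 \<le> m" "m \<le> t" "\<And>s. 0 \<le> s \<Longrightarrow> s \<le> t \<Longrightarrow> g s \<le> g m"
    using continuous_attains_sup[of "{0..t}" g] t by auto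
  have le: "\<bar>y s\<bar> \<le> g m * (1 + s) powr - \<alpha>" if "0 \<le> s" "s \<le> t" for s
    using m(3)[OF that] that by (simp add: g mult_right_mono)
  have "g m \<le> \<bar>y 0\<bar>"
  proof (rule ccontr)
    assume "\<not> g m \<le> \<bar>y 0\<bar>"
    \<comment> \<open>Here \<open>g 0 = \<bar>y 0\<bar>\<close>, so a maximum exceeding this value
      is not attained at 0.\<close>
    then have "g m > 0" "m \<noteq> 0" by (auto simp: g_def)
    then have "m > 0" using m by simp
    \<comment> \<open>By linearity the sign can be absorbed into the solution, which turns the bound
      on the absolute value into a one-sided barrier touched at \<open>m\<close>.\<close>
    have "sgn (y m) * y s \<le> g m * (1 + s) powr - \<alpha>" if "0 \<le> s" "s \<le> m" for s
      using le[of s] that m by (auto simp: sgn_if split: if_splits)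
    moreover have "sgn (y m) * y m = g m * (1 + m) powr - \<alpha>"
      using g[OF m(1)] by (simp add: sgn_mult_self_eq abs_sgn mult.commute)
    ultimately show False
      using ambartsumian_no_interior_touching
        [OF ambartsumian_solution_cmult[OF sol, of "sgn (y m)"] q \<alpha> \<open>g m > 0\<close> \<open>m > 0\<close>]
      by blast
  qed
  then have "g m * (1 + t) powr - \<alpha> \<le> \<bar>y 0\<bar> * (1 + t) powr - \<alpha>"
    by (intro mult_right_mono) auto
  then show ?thesis
    using le[of t] t by linarith
qed

lemma ambartsumian_solution_exists:
  fixes q c :: real
  assumes q: "q > 1"
  shows "\<exists>y. ambartsumian_solution q y \<and> y 0 = c"
proof -
  \<comment> \<open>Comparing coefficients gives
    \<open>(n + 1) * a (n + 1) = ((1 / q) ^ (n + 1) - 1) * a n\<close> with \<open>a 0 = c\<close>.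
    The exponent is \<open>Suc k\<close> because the factor \<open>1 / q\<close> of the equation
    joins the \<open>(1 / q) ^ k\<close> from rescaling the argument.\<close>
  define a where "a = (\<lambda>n. c * (\<Prod>k<n. (1 / q) ^ Suc k - 1) / fact n)"
  have diffs_a: "diffs a n = - a n + (1 / q) * ((1 / q) ^ n * a n)" for n
    using q by (simp add: diffs_def a_def field_simps del: of_nat_Suc)
  \<comment> \<open>Each factor of the product lies in [-1, 0], so the series is dominated by an
    exponential series and converges everywhere.\<close>
  have norm_a: "norm (a n) \<le> \<bar>c\<bar> * inverse (fact n)" for n
  proof -
    have "(1 / q) ^ Suc k \<le> 1" "(1 / q) ^ Suc k \<ge> 0" for k
      using q by (auto intro!: power_le_one simp del: power_Suc)
    then have "\<bar>(1 / q) ^ Suc k - 1\<bar> \<le> 1" for k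
      by (simp add: abs_le_iff)
    then have "(\<Prod>k<n. \<bar>(1 / q) ^ Suc k - 1\<bar>) \<le> 1"
      by (intro prod_le_1) auto
    then have "\<bar>c\<bar> * (\<Prod>k<n. \<bar>(1 / q) ^ Suc k - 1\<bar>) \<le> \<bar>c\<bar> * 1"
      by (intro mult_left_mono) auto
    then show ?thesis
      by (simp add: a_def abs_mult abs_prod divide_inverse mult_right_mono del: power_Suc)
  qed
  have sum_a: "summable (\<lambda>n. a n * x ^ n)" for x
  proof (rule summable_comparison_test')
    show "summable (\<lambda>n. \<bar>c\<bar> * (inverse (fact n) * \<bar>x\<bar> ^ n))"
      using summable_mult summable_exp by blast
    show "norm (a n * x ^ n) \<le> \<bar>c\<bar> * (inverse (fact n) * \<bar>x\<bar> ^ n)" if "n \<ge> 0" for n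
      using mult_right_mono[OF norm_a[of n], of "\<bar>x\<bar> ^ n"]
      by (simp add: abs_mult power_abs mult.assoc)
  qed
  define y where "y = (\<lambda>x. \<Sum>n. a n * x ^ n)"
  have "(y has_real_derivative - y x + (1 / q) * y (x / q)) (at x)" for x
  proof -
    have "(y has_real_derivative (\<Sum>n. diffs a n * x ^ n)) (at x)"
      unfolding y_def by (rule termdiffs_strong_converges_everywhere) (rule sum_a)
    also have "(\<lambda>n. diffs a n * x ^ n) = (\<lambda>n. - (a n * x ^ n) + (1 / q) * (a n * (x / q) ^ n))"
      by (rule ext) (simp add: diffs_a power_divide algebra_simps)
    also have "suminf \<dots> = (\<Sum>n. - (a n * x ^ n)) + (\<Sum>n. (1 / q) * (a n * (x / q) ^ n))"
      by (intro suminf_add[symmetric] summable_minus summable_mult sum_a)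
    also have "\<dots> = - y x + (1 / q) * y (x / q)"
      unfolding y_def by (simp only: suminf_minus[OF sum_a] suminf_mult[OF sum_a])
    finally show ?thesis .
  qed
  then have "ambartsumian_solution q y"
    by (simp add: ambartsumian_solution_def has_field_derivative_at_within)
  moreover have "y 0 = c"
    unfolding y_def using powser_sums_zero[of a] by (simp add: a_def sums_iff)
  ultimately show ?thesis by blast
qed

text \<open>For \<open>t\<close> \<ge> 0 the equation looks only at nonnegative arguments,
  \<open>t / q\<close> included. This lets a solution be made extensional.\<close>

lemma ambartsumian_solution_cong:
  assumes "ambartsumian_solution q y" "q > 1" "\<And>t. t \<ge> 0 \<Longrightarrow> z t = y t"
  shows "ambartsumian_solution q z"
  unfolding ambartsumian_solution_def
proof (intro allI impI)
  fix t :: real assume t: "t \<ge> 0"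
  have "(y has_real_derivative - z t + (1 / q) * z (t / q)) (at t within {0..})"
    using assms t by (simp add: ambartsumian_solution_def)
  then show "(z has_real_derivative - z t + (1 / q) * z (t / q)) (at t within {0..})"
    using t assms(3) by (elim has_field_derivative_transform_within[OF _ zero_less_one]) auto
qed

text \<open>Justifies the definite description: the power series, restricted to the half-line, gives
  existence, and the decay bound gives uniqueness.\<close>

lemma ambartsumian_sol:
  fixes q c :: real
  assumes q: "q > 1"
  shows "ambartsumian_solution q (ambartsumian_sol q c)" "ambartsumian_sol q c 0 = c"
proof -
  have "\<exists>!y. y \<in> extensional {0..} \<and> ambartsumian_solution q y \<and> y 0 = c"
  proof (rule ex_ex1I)
    obtain y where y: "ambartsumian_solution q y" "y 0 = c"
      using ambartsumian_solution_exists[OF q] by blast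
    have "ambartsumian_solution q (restrict y {0..})"
      by (rule ambartsumian_solution_cong[OF y(1) q]) simp
    then show "\<exists>y. y \<in> extensional {0..} \<and> ambartsumian_solution q y \<and> y 0 = c"
      using y(2) by (intro exI[of _ "restrict y {0..}"]) auto
  next
    fix y z
    assume y: "y \<in> extensional {0..} \<and> ambartsumian_solution q y \<and> y 0 = c"
      and z: "z \<in> extensional {0..} \<and> ambartsumian_solution q z \<and> z 0 = c"
    obtain \<alpha> where \<alpha>: "\<alpha> > 0" "\<alpha> + q powr \<alpha> / q < 1"
      using exists_decay_exponent[OF q] by blast
    \<comment> \<open>The difference has initial value 0, so the decay bound forces it to vanish on
      the half-line.\<close>
    have "ambartsumian_solution q (\<lambda>t. y t - z t)"
      using y z by (simp add: ambartsumian_solution_diff)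
    from ambartsumian_solution_bound[OF this q \<alpha>]
    have "\<bar>y t - z t\<bar> \<le> 0" if "t \<ge> 0" for t
      using that y z by (metis abs_zero diff_self mult_zero_left)
    then show "y = z"
      using y z by (intro extensionalityI[of y "{0..}" z]) auto
  qed
  from theI'[OF this] show "ambartsumian_solution q (ambartsumian_sol q c)"
    "ambartsumian_sol q c 0 = c"
    unfolding ambartsumian_sol_def by blast+
qed

theorem theorem12:
  fixes q :: real
  assumes "q > 1"
  shows "zero_asymptotically_stable (ambartsumian_sol q)"
proof -
  obtain \<alpha> where \<alpha>: "\<alpha> > 0" "\<alpha> + q powr \<alpha> / q < 1"
    using exists_decay_exponent[OF assms] by blast
  have bound: "\<bar>ambartsumian_sol q c t\<bar> \<le> \<bar>c\<bar> * (1 + t) powr - \<alpha>" if "t \<ge> 0" for c t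
    using ambartsumian_solution_bound[OF ambartsumian_sol(1)[OF assms] assms \<alpha> that, of c]
    by (simp add: ambartsumian_sol(2)[OF assms])
  have "\<bar>ambartsumian_sol q c t\<bar> \<le> \<bar>c\<bar>" if "t \<ge> 0" for c t
  proof -
    have "(1 + t) powr - \<alpha> \<le> (1 + t) powr 0"
      using \<alpha> that by (intro powr_mono) auto
    then have "\<bar>c\<bar> * (1 + t) powr - \<alpha> \<le> \<bar>c\<bar> * 1"
      using that by (intro mult_left_mono) auto
    then show ?thesis using bound[OF that, of c] by simp
  qed
  \<comment> \<open>The bound by \<open>\<bar>c\<bar>\<close> allows the choice \<delta> =
    \<epsilon>.\<close>
  then have "zero_stable (ambartsumian_sol q)"
    unfolding zero_stable_def using le_less_trans by blast
  moreover have "((\<lambda>t. \<bar>ambartsumian_sol q c t\<bar>) \<longlongrightarrow> 0) at_top" for c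
  proof (rule tendsto_sandwich[of "\<lambda>_. 0"])
    have "filterlim (\<lambda>t::real. 1 + t) at_top at_top"
      by (rule filterlim_tendsto_add_at_top[OF tendsto_const filterlim_ident])
    then have "((\<lambda>t. (1 + t) powr - \<alpha>) \<longlongrightarrow> 0) at_top"
      using \<alpha> by (intro tendsto_neg_powr) auto
    then show "((\<lambda>t. \<bar>c\<bar> * (1 + t) powr - \<alpha>) \<longlongrightarrow> 0) at_top"
      by (rule tendsto_mult_right_zero)
    show "\<forall>\<^sub>F t in at_top. \<bar>ambartsumian_sol q c t\<bar> \<le> \<bar>c\<bar> * (1 + t) powr - \<alpha>"
      using eventually_ge_at_top[of 0] by eventually_elim (rule bound)
  qed auto
  \<comment> \<open>Decay holds for every \<open>c\<close>, so the radius \<delta> = 1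
    serves.\<close>
  ultimately show ?thesis
    unfolding zero_asymptotically_stable_def using zero_less_one by blast
qed

end
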